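(* Let $m\ge 1$ and let $K_{m,1}$ be the star graph with $m$ leaves (so it has $m+1$ vertices). The Smith normal form of the $(m+1)\times(m+1)$ matrix $D^{\deg}_+(K_{m,1})$ is $$\operatorname{diag}(1,\dots,1,2m(m-1)),$$ and the Smith normal form of the $(m+1)\times(m+1)$ matrix $D^{\deg}(K_{m,1})$ is $$\begin{cases}\operatorname{diag}(1,3,\dots,3,2m(m-1)) & \text{if } 2m+1=3a \text{ for some } a\in\mathbb{Z},\\ \operatorname{diag}(1,1,3,\dots,3,6m(m-1)) & \text{otherwise.}\end{cases}$$
   Context: For a connected graph $G$, $D(G)$ is the distance matrix, with $uv$-entry the number of edges in a shortest path between $u$ and $v$, and $\deg(G)$ is the diagonal matrix of vertex degrees. Define $D^{\deg}(G)=\deg(G)-D(G)$ and $D^{\deg}_+(G)=\deg(G)+D(G)$. The Smith normal form of a square integer matrix $M$ of size $N$ is the unique diagonal matrix $\operatorname{diag}(f_1,\dots,f_r,0,\dots,0)=PMQ$ with $P,Q\in GL_N(\mathbb{Z})$, $f_i$ positive integers, $f_i\mid f_{i+1}$, $r$ the rank of $M$. In the displayed diagonal matrices the dots stand for as many repeated entries as needed to have $m+1$ diagonal entries in total. *)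

theory Defs
  imports "Jordan_Normal_Form.DL_Rank"
begin

(* A graph is a pair (N, E): the vertices are 0, ..., N - 1 and E is a set of two-element
   vertex sets.  This fixes the order in which vertices index rows and columns of matrices. *)

type_synonym graph = "nat \<times> nat set set"

definition verts :: "graph \<Rightarrow> nat set" where
  "verts G = {..<fst G}"

definition adj :: "graph \<Rightarrow> nat \<Rightarrow> nat \<Rightarrow> bool" where
  "adj G u v \<longleftrightarrow> {u, v} \<in> snd G"

definition simple_graph :: "graph \<Rightarrow> bool" where
  "simple_graph G \<longleftrightarrow> (\<forall>e \<in> snd G. e \<subseteq> verts G \<and> card e = 2)"

definition path_between :: "graph \<Rightarrow> nat \<Rightarrow> nat \<Rightarrow> nat list \<Rightarrow> bool" where
  "path_between G u v p \<longleftrightarrow>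
     p \<noteq> [] \<and> hd p = u \<and> last p = v \<and> set p \<subseteq> verts G \<and> distinct p \<and> successively (adj G) p"

definition connected_graph :: "graph \<Rightarrow> bool" where
  "connected_graph G \<longleftrightarrow>
     verts G \<noteq> {} \<and> (\<forall>u \<in> verts G. \<forall>v \<in> verts G. \<exists>p. path_between G u v p)"

(* A path listed by its vertices has length p - 1 edges.  Only meaningful when some path
   exists, hence for connected graphs. *)

definition graph_dist :: "graph \<Rightarrow> nat \<Rightarrow> nat \<Rightarrow> nat" where
  "graph_dist G u v = (LEAST k. \<exists>p. path_between G u v p \<and> length p - 1 = k)"

definition vdegree :: "graph \<Rightarrow> nat \<Rightarrow> nat" where
  "vdegree G v = card {u \<in> verts G. adj G v u}"

definition dist_mat :: "graph \<Rightarrow> int mat" where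
  "dist_mat G = mat (fst G) (fst G) (\<lambda>(u, v). int (graph_dist G u v))"

definition deg_mat :: "graph \<Rightarrow> int mat" where
  "deg_mat G = mat_diag (fst G) (\<lambda>v. int (vdegree G v))"

definition D_deg :: "graph \<Rightarrow> int mat" where
  "D_deg G = deg_mat G - dist_mat G"

definition D_deg_plus :: "graph \<Rightarrow> int mat" where
  "D_deg_plus G = deg_mat G + dist_mat G"

definition complete_bipartite :: "nat \<Rightarrow> nat \<Rightarrow> graph" where
  "complete_bipartite m n = (m + n, {{i, j} | i j. i < m \<and> m \<le> j \<and> j < m + n})"

lemma simple_graph_complete_bipartite: "simple_graph (complete_bipartite m n)"
  by (auto simp: simple_graph_def complete_bipartite_def verts_def card_insert_if)

lemma connected_graph_complete_bipartite:
  assumes "m \<ge> 1" "n \<ge> 1"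
  shows "connected_graph (complete_bipartite m n)"
proof -
  let ?G = "complete_bipartite m n"
  have V: "verts ?G = {..<m + n}"
    by (simp add: verts_def complete_bipartite_def)
  have adj: "adj ?G i j" "adj ?G j i" if "i < m" "m \<le> j" "j < m + n" for i j
    using that by (auto simp: adj_def complete_bipartite_def)
  have "\<exists>p. path_between ?G u v p" if u: "u < m + n" and v: "v < m + n" for u v
  proof -
    consider "u = v" | "u \<noteq> v" "u < m" "v < m" | "u \<noteq> v" "m \<le> u" "m \<le> v"
      | "u < m" "m \<le> v" | "m \<le> u" "v < m"
      by linarith
    then show ?thesis
    proof cases
      case 1
      then have "path_between ?G u v [u]" using u by (simp add: path_between_def V)
      then show ?thesis ..
    next
      case 2
      then have "path_between ?G u v [u, m, v]"
        using u v assms by (simp add: path_between_def V adj)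
      then show ?thesis ..
    next
      case 3
      then have "path_between ?G u v [u, 0, v]"
        using u v assms by (auto simp: path_between_def V adj)
      then show ?thesis ..
    next
      case 4
      then have "path_between ?G u v [u, v]"
        using u v by (auto simp: path_between_def V adj)
      then show ?thesis ..
    next
      case 5
      then have "path_between ?G u v [u, v]"
        using u v by (auto simp: path_between_def V adj)
      then show ?thesis ..
    qed
  qed
  then show ?thesis
    using assms by (auto simp: connected_graph_def V lessThan_empty_iff)
qed

definition GL_int :: "nat \<Rightarrow> int mat set" where
  "GL_int N = {P \<in> carrier_mat N N. invertible_mat P}"

definition int_mat_rank :: "int mat \<Rightarrow> nat" where
  "int_mat_rank M = vec_space.rank (dim_row M) (map_mat rat_of_int M)"

(* "S is the Smith normal form of the N x N matrix M".  The invariant factors f_1, ..., f_r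
   are f 0, ..., f (r - 1) here. *)

definition is_smith_normal_form :: "nat \<Rightarrow> int mat \<Rightarrow> int mat \<Rightarrow> bool" where
  "is_smith_normal_form N M S \<longleftrightarrow>
     M \<in> carrier_mat N N \<and>
     (\<exists>P \<in> GL_int N. \<exists>Q \<in> GL_int N. \<exists>r f.
        r = int_mat_rank M \<and> r \<le> N \<and>
        (\<forall>i < r. f i > 0) \<and>
        (\<forall>i. Suc i < r \<longrightarrow> f i dvd f (Suc i)) \<and>
        S = mat_diag N (\<lambda>i. if i < r then f i else 0) \<and>
        S = P * M * Q)"

definition diag_of_list :: "int list \<Rightarrow> int mat" where
  "diag_of_list xs = mat_diag (length xs) (\<lambda>i. xs ! i)"

end

theory Submission
  imports Defs
begin

text \<open>
Number the leaves \<open>0, \<dots>, m - 1\<close> and the centre \<open>m\<close>. Two leaves are at distance 2 and a leaf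
is at distance 1 from the centre. With \<open>J\<close> the all-ones matrix on the leaves, the leaf block of
\<open>D_deg_plus\<close> is therefore \<open>2J - I\<close>, bordered by entries \<open>1\<close>, and that of \<open>D_deg\<close> is \<open>3I - 2J\<close>,
bordered by entries \<open>-1\<close>; both have \<open>m\<close> in the corner.

Subtracting twice the row of the centre from every leaf row removes \<open>J\<close> in both cases: the leaf rows
become \<open>- e\<^sub>i + (1 - 2m) e\<^sub>m\<close> and \<open>3 e\<^sub>i - (2m + 1) e\<^sub>m\<close> respectively.

In the first case the entries \<open>-1\<close> are pivots that clear everything else and leave \<open>2m(m - 1)\<close> in
the corner. All these operations treat the leaves alike, so they happen inside the algebra of
block matrices \<open>star_mat\<close>, in which products are computed by a closed formula.

In the second case write \<open>2m + 1 = 3q - s\<close> with \<open>s\<close> in \<open>{0, 1, -1}\<close>. Adding \<open>q\<close> times every leaf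
column to the last column turns the leaf rows into \<open>3 e\<^sub>i + s e\<^sub>m\<close>. Now leaf 0 is singled out: its
entry \<open>-1\<close> in the row of the centre is a pivot, and the combination of all rows that kills the leaf
columns puts \<open>2m(m - 1)\<close> in the corner. What remains is the triangular matrix \<open>arrow_mat\<close> with
rows \<open>e\<^sub>0\<close>, \<open>3 e\<^sub>j + s e\<^sub>m\<close> for the other leaves \<open>j\<close>, and \<open>2m(m - 1) e\<^sub>m\<close>. If \<open>s = 0\<close>, that is, if 3 divides
\<open>2m + 1\<close>, this is diagonal. Otherwise \<open>s\<close> is a unit and serves as a second pivot, in the row of
leaf 1, at the cost of multiplying the last invariant factor by 3.

The definition of the normal form also asks for the rank. Here the diagonal form has at most one
zero, in the last place, so the rank is decided by the determinant and by subadditivity of the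
rank (\<open>is_smith_normal_formI\<close>).
\<close>

section \<open>Unimodular equivalence of integer matrices\<close>

text \<open>Over a commutative ring a one-sided inverse suffices, because it makes the determinant a unit
and the adjugate then yields the other side.\<close>

lemma GL_intI:
  assumes A: "A \<in> carrier_mat N N" and B: "B \<in> carrier_mat N N" and AB: "A * B = 1\<^sub>m N"
  shows "A \<in> GL_int N"
proof -
  have "det A * det B = 1"
    using det_mult[OF A B] AB by simp
  then have unit: "det A * det A = 1"
    by (metis dvd_triv_left mult.commute mult_1_right zdvd1_eq zmult_eq_1_iff abs_mult_self_eq)
  define C where "C = det A \<cdot>\<^sub>m adj_mat A"
  have C: "C \<in> carrier_mat N N"
    using adj_mat(1)[OF A] by (simp add: C_def)
  have "C * A = det A \<cdot>\<^sub>m (adj_mat A * A)"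
    unfolding C_def by (rule mult_smult_assoc_mat[OF adj_mat(1)[OF A] A])
  also have "\<dots> = 1\<^sub>m N"
    unfolding adj_mat(3)[OF A] using unit by (intro eq_matI) auto
  finally have CA: "C * A = 1\<^sub>m N" .
  have "C = C * (A * B)"
    using C AB by simp
  also have "\<dots> = B"
    using assoc_mult_mat[OF C A B] CA B by simp
  finally have "B * A = 1\<^sub>m N"
    using CA by simp
  then show ?thesis
    using A B AB unfolding GL_int_def invertible_mat_def inverts_mat_def by auto
qed

lemma GL_int_carrier: "P \<in> GL_int N \<Longrightarrow> P \<in> carrier_mat N N"
  by (simp add: GL_int_def)

lemma GL_int_inverse:
  assumes "P \<in> GL_int N"
  obtains P' where "P' \<in> GL_int N" "P * P' = 1\<^sub>m N" "P' * P = 1\<^sub>m N"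
proof -
  have P: "P \<in> carrier_mat N N"
    using assms by (rule GL_int_carrier)
  obtain B where B: "P * B = 1\<^sub>m (dim_row P)" "B * P = 1\<^sub>m (dim_row B)"
    using assms unfolding GL_int_def invertible_mat_def inverts_mat_def by blast
  have "dim_col B = N"
    using arg_cong[OF B(1), of dim_col] P by simp
  moreover have "dim_row B = N"
    using arg_cong[OF B(2), of dim_col] P by simp
  ultimately have "B \<in> carrier_mat N N" by auto
  then show ?thesis
    using that[of B] GL_intI[of B N P] B P by auto
qed

lemma GL_int_mult:
  assumes "P \<in> GL_int N" "Q \<in> GL_int N"
  shows "P * Q \<in> GL_int N"
proof -
  obtain P' Q' where P': "P' \<in> GL_int N" "P * P' = 1\<^sub>m N" and Q': "Q' \<in> GL_int N" "Q * Q' = 1\<^sub>m N"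
    using assms by (metis GL_int_inverse)
  note carr = assms[THEN GL_int_carrier] P'(1)[THEN GL_int_carrier] Q'(1)[THEN GL_int_carrier]
  have "(P * Q) * (Q' * P') = P * ((Q * Q') * P')"
    using carr by (simp add: assoc_mult_mat[of _ N N _ N _ N])
  also have "\<dots> = 1\<^sub>m N"
    using carr P' Q' by simp
  finally show ?thesis
    using carr by (intro GL_intI[of _ _ "Q' * P'"]) auto
qed

lemma GL_int_det:
  assumes "P \<in> GL_int N"
  shows "det P \<noteq> 0"
proof -
  obtain P' where P': "P' \<in> GL_int N" "P * P' = 1\<^sub>m N"
    using assms by (metis GL_int_inverse)
  then have "det P * det P' = 1"
    using det_mult[OF GL_int_carrier GL_int_carrier, OF assms P'(1)] by simp
  then show ?thesis by auto
qed

text \<open>The second factor stands next to \<open>B\<close>, so that the relation can be checked without inverting it: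
when \<open>B\<close> is diagonal or sparse, \<open>B * R\<close> is read off from the rows of \<open>R\<close>.\<close>

definition unimodular_equiv :: "nat \<Rightarrow> int mat \<Rightarrow> int mat \<Rightarrow> bool" where
  "unimodular_equiv N A B \<longleftrightarrow> (\<exists>P \<in> GL_int N. \<exists>R \<in> GL_int N. P * A = B * R)"

lemma unimodular_equivI:
  assumes "P \<in> carrier_mat N N" "P' \<in> carrier_mat N N" "P * P' = 1\<^sub>m N"
    and "R \<in> carrier_mat N N" "R' \<in> carrier_mat N N" "R * R' = 1\<^sub>m N"
    and "P * A = B * R"
  shows "unimodular_equiv N A B"
  unfolding unimodular_equiv_def
  using GL_intI[OF assms(1-3)] GL_intI[OF assms(4-6)] assms(7) by blast

lemma unimodular_equiv_trans:
  assumes "unimodular_equiv N A B" "unimodular_equiv N B C"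
    and A: "A \<in> carrier_mat N N" and B: "B \<in> carrier_mat N N" and C: "C \<in> carrier_mat N N"
  shows "unimodular_equiv N A C"
proof -
  obtain P R P' R' where GL: "P \<in> GL_int N" "R \<in> GL_int N" "P' \<in> GL_int N" "R' \<in> GL_int N"
    and eq: "P * A = B * R" "P' * B = C * R'"
    using assms(1,2) unfolding unimodular_equiv_def by blast
  note carr = GL[THEN GL_int_carrier] A B C
  have "(P' * P) * A = P' * (B * R)"
    using carr eq(1) by (simp add: assoc_mult_mat[of _ N N _ N _ N])
  also have "\<dots> = (P' * B) * R"
    using carr by (simp add: assoc_mult_mat[of _ N N _ N _ N])
  also have "\<dots> = C * (R' * R)"
    unfolding eq(2) using carr by (simp add: assoc_mult_mat[of _ N N _ N _ N])
  finally show ?thesis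
    unfolding unimodular_equiv_def using GL GL_int_mult by blast
qed

section \<open>Diagonal forms of corank at most one\<close>

lemma det_mat_diag: "det (mat_diag N f) = (\<Prod>i<N. f i)"
  for f :: "nat \<Rightarrow> 'a::comm_ring_1"
proof -
  have "det (mat_diag N f) = prod_list (diag_mat (mat_diag N f))"
    by (rule det_upper_triangular[of _ N]) (auto simp: mat_diag_def upper_triangular_def)
  also have "diag_mat (mat_diag N f) = map f [0..<N]"
    by (auto simp: diag_mat_def mat_diag_def intro: map_cong)
  also have "prod_list \<dots> = (\<Prod>i<N. f i)"
    by (simp add: prod.distinct_set_conv_list[symmetric] lessThan_atLeast0)
  finally show ?thesis .
qed

lemma det_unimodular_product_eq_0_iff:
  assumes "L \<in> GL_int N" "R \<in> GL_int N"
  shows "det (L * mat_diag N f * R) = 0 \<longleftrightarrow> (\<exists>i<N. f i = 0)"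
proof -
  note carr = assms[THEN GL_int_carrier]
  have "det (L * mat_diag N f * R) = det L * (\<Prod>i<N. f i) * det R"
    using carr by (simp add: det_mult[of _ N] det_mat_diag)
  then show ?thesis
    using assms[THEN GL_int_det] by auto
qed

lemma int_mat_rank_full_iff:
  assumes "M \<in> carrier_mat N N"
  shows "int_mat_rank M = N \<longleftrightarrow> det M \<noteq> 0"
proof -
  have "map_mat rat_of_int M \<in> carrier_mat N N"
    using assms by simp
  from vec_space.det_rank_iff[OF this] show ?thesis
    using assms by (auto simp: int_mat_rank_def)
qed

lemma int_mat_rank_add_rank_one:
  fixes x y :: "nat \<Rightarrow> int"
  assumes M: "M \<in> carrier_mat N N"
  shows "int_mat_rank (M + mat N N (\<lambda>(i, j). x i * y j)) \<le> int_mat_rank M + 1"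
proof -
  let ?E = "mat N N (\<lambda>(i, j). x i * y j) :: int mat"
  let ?r = "map_mat rat_of_int"
  have "vec_space.rank N (?r ?E) \<le> 1"
    by (rule vec_space.rank_le_1_product_entries
        [where f = "\<lambda>i. of_int (x i)" and g = "\<lambda>j. of_int (y j)"]) auto
  moreover have "vec_space.rank N (?r M + ?r ?E) \<le> vec_space.rank N (?r M) + vec_space.rank N (?r ?E)"
    using M by (intro vec_space.rank_subadditive) auto
  moreover have "?r (M + ?E) = ?r M + ?r ?E"
    using M by (intro eq_matI) auto
  ultimately show ?thesis
    using M by (simp add: int_mat_rank_def)
qed

text \<open>When the last diagonal entry is zero, the matrix is singular, so its rank is at most \<open>m\<close>; it
is at least \<open>m\<close> because a rank one correction makes the matrix nonsingular.\<close>

lemma is_smith_normal_formI: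
  assumes M: "M \<in> carrier_mat (Suc m) (Suc m)"
    and equiv: "unimodular_equiv (Suc m) M (mat_diag (Suc m) f)"
    and pos: "\<And>i. i < m \<Longrightarrow> f i > 0" and last: "f m \<ge> 0"
    and dvd: "\<And>i. i < m \<Longrightarrow> f i dvd f (Suc i)"
  shows "is_smith_normal_form (Suc m) M (mat_diag (Suc m) f)"
proof -
  let ?N = "Suc m"
  define S where "S = mat_diag ?N f"
  have S: "S \<in> carrier_mat ?N ?N" by (simp add: S_def)
  obtain P R where P: "P \<in> GL_int ?N" and R: "R \<in> GL_int ?N" and eq: "P * M = S * R"
    using equiv unfolding unimodular_equiv_def S_def by blast
  obtain L where L: "L \<in> GL_int ?N" "L * P = 1\<^sub>m ?N"
    using P by (metis GL_int_inverse)
  obtain Q where Q: "Q \<in> GL_int ?N" "R * Q = 1\<^sub>m ?N"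
    using R by (metis GL_int_inverse)
  note carr = M S P[THEN GL_int_carrier] R[THEN GL_int_carrier] L(1)[THEN GL_int_carrier]
    Q(1)[THEN GL_int_carrier]
  have "P * M * Q = S * (R * Q)"
    unfolding eq using carr by (simp add: assoc_mult_mat[of _ ?N ?N _ ?N _ ?N])
  then have SPMQ: "S = P * M * Q"
    using carr Q by simp
  have "L * S * R = (L * P) * M"
    using carr eq by (simp add: assoc_mult_mat[of _ ?N ?N _ ?N _ ?N])
  then have MLSR: "M = L * S * R"
    using carr L by simp
  define r where "r = (if f m = 0 then m else ?N)"
  have rank: "int_mat_rank M = r"
  proof (cases "f m = 0")
    case False
    then have "\<not> (\<exists>i<?N. f i = 0)"
      using pos by (force simp: less_Suc_eq)
    then have "det M \<noteq> 0"
      unfolding MLSR S_def det_unimodular_product_eq_0_iff[OF L(1) R] .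
    then show ?thesis
      using False int_mat_rank_full_iff[OF M] by (simp add: r_def)
  next
    case True
    have "det M = 0"
      unfolding MLSR S_def det_unimodular_product_eq_0_iff[OF L(1) R] using True by blast
    then have "int_mat_rank M \<noteq> ?N"
      using int_mat_rank_full_iff[OF M] by simp
    moreover have "int_mat_rank M \<le> ?N"
      using M vec_space.rank_le_nc[of "map_mat rat_of_int M" ?N ?N] by (simp add: int_mat_rank_def)
    moreover have "?N \<le> int_mat_rank M + 1"
    proof -
      \<comment> \<open>Turning the zero in the corner of \<open>S\<close> into a one changes \<open>M\<close> by a rank one matrix.\<close>
      let ?f = "f(m := 1)"
      let ?E = "mat ?N ?N (\<lambda>(i, j). L $$ (i, m) * R $$ (m, j)) :: int mat"
      have "M + ?E = L * mat_diag ?N ?f * R"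
        unfolding MLSR S_def using carr True
        by (intro eq_matI)
          (auto simp: mat_diag_mult_right[of _ ?N] scalar_prod_def)
      moreover have "\<not> (\<exists>i<?N. ?f i = 0)"
        using pos by (force simp: less_Suc_eq)
      ultimately have "det (M + ?E) \<noteq> 0"
        using det_unimodular_product_eq_0_iff[OF L(1) R, of ?f] by simp
      moreover have "M + ?E \<in> carrier_mat ?N ?N"
        using M by simp
      ultimately have "int_mat_rank (M + ?E) = ?N"
        using int_mat_rank_full_iff by blast
      then show ?thesis
        using int_mat_rank_add_rank_one[OF M, of "\<lambda>i. L $$ (i, m)" "\<lambda>j. R $$ (m, j)"] by simp
    qed
    ultimately show ?thesis
      using True by (simp add: r_def)
  qed
  have "S = mat_diag ?N (\<lambda>i. if i < r then f i else 0)"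
    unfolding S_def mat_diag_def r_def by (intro eq_matI) (auto simp: less_Suc_eq)
  moreover have "\<forall>i<r. f i > 0"
    using pos last by (auto simp: r_def less_Suc_eq split: if_splits)
  moreover have "\<forall>i. Suc i < r \<longrightarrow> f i dvd f (Suc i)"
    using dvd by (auto simp: r_def split: if_splits)
  moreover have "r \<le> ?N" by (simp add: r_def)
  ultimately show ?thesis
    unfolding is_smith_normal_form_def S_def[symmetric]
    using M P Q(1) SPMQ rank by blast
qed

section \<open>The algebra of matrices with star symmetry\<close>

text \<open>The block matrix with \<open>a I + b J\<close> on the leaves, \<open>c\<close> in the column and \<open>d\<close> in the row of the
centre, and \<open>e\<close> in the corner. For \<open>m \<ge> 2\<close> these are exactly the matrices invariant under all
permutations of the leaves, which is why they are closed under multiplication.\<close>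

definition star_mat :: "nat \<Rightarrow> int \<Rightarrow> int \<Rightarrow> int \<Rightarrow> int \<Rightarrow> int \<Rightarrow> int mat" where
  "star_mat m a b c d e = mat (Suc m) (Suc m) (\<lambda>(i, j).
     if i < m then (if j < m then (if i = j then a else 0) + b else c)
     else (if j < m then d else e))"

lemma star_mat_carrier [simp]: "star_mat m a b c d e \<in> carrier_mat (Suc m) (Suc m)"
  by (simp add: star_mat_def)

lemma sum_delta_mult:
  fixes f :: "nat \<Rightarrow> int"
  shows "(\<Sum>k = 0..<n. (if k = i then x else 0) * f k) = (if i < n then x * f i else 0)"
    and "(\<Sum>k = 0..<n. (if i = k then x else 0) * f k) = (if i < n then x * f i else 0)"
    and "(\<Sum>k = 0..<n. f k * (if k = i then x else 0)) = (if i < n then f i * x else 0)"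
    and "(\<Sum>k = 0..<n. f k * (if i = k then x else 0)) = (if i < n then f i * x else 0)"
    and "(\<Sum>k = 0..<n. (if k = i then x else 0)) = (if i < n then x else 0)"
    and "(\<Sum>k = 0..<n. (if i = k then x else 0)) = (if i < n then x else 0)"
  by (simp_all add: if_distrib[of "\<lambda>t. t * _"] if_distrib[of "\<lambda>t. _ * t"] cong: if_cong)

lemma mat_mult_index_sum:
  fixes f g :: "nat \<times> nat \<Rightarrow> int"
  assumes "i < N" "j < N"
  shows "(mat N N f * mat N N g) $$ (i, j) = (\<Sum>k = 0..<N. f (i, k) * g (k, j))"
  using assms by (simp add: scalar_prod_def)

lemma star_mat_mult:
  "star_mat m a b c d e * star_mat m a' b' c' d' e' =
   star_mat m (a * a') (a * b' + b * a' + int m * b * b' + c * d')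
     (a * c' + int m * b * c' + c * e') (d * a' + int m * d * b' + e * d')
     (int m * d * c' + e * e')"
  (is "?L = ?R")
proof (rule eq_matI)
  fix i j assume "i < dim_row ?R" "j < dim_col ?R"
  then have ij: "i < Suc m" "j < Suc m" by (simp_all add: star_mat_def)
  show "?L $$ (i, j) = ?R $$ (i, j)"
    unfolding star_mat_def mat_mult_index_sum[OF ij] using ij
    by (simp add: less_Suc_eq sum.distrib distrib_left distrib_right sum_delta_mult
        sum_distrib_left[symmetric] sum_distrib_right[symmetric] algebra_simps)
qed (simp_all add: star_mat_def)

lemma star_mat_one: "star_mat m 1 0 0 0 1 = 1\<^sub>m (Suc m)"
  by (intro eq_matI) (auto simp: star_mat_def)

section \<open>The matrices of a star graph\<close>

definition star_graph :: "nat \<Rightarrow> graph" where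
  "star_graph m = complete_bipartite m 1"

lemma verts_star: "verts (star_graph m) = {..<Suc m}"
  by (simp add: verts_def star_graph_def complete_bipartite_def)

lemma adj_star:
  "adj (star_graph m) u v \<longleftrightarrow> (u < m \<and> v = m) \<or> (u = m \<and> v < m)"
  by (auto simp: adj_def star_graph_def complete_bipartite_def doubleton_eq_iff)

lemma vdegree_star:
  assumes "v < Suc m"
  shows "vdegree (star_graph m) v = (if v < m then 1 else m)"
proof (cases "v < m")
  case True
  then have "{u \<in> {..<Suc m}. adj (star_graph m) v u} = {m}"
    by (auto simp: adj_star)
  then show ?thesis using True by (simp add: vdegree_def verts_star)
next
  case False
  then have "{u \<in> {..<Suc m}. adj (star_graph m) v u} = {..<m}"
    using assms by (auto simp: adj_star)
  then show ?thesis using False by (simp add: vdegree_def verts_star)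
qed

lemma graph_dist_eqI:
  assumes "path_between G u v p" "length p = Suc k"
    and "\<And>q. path_between G u v q \<Longrightarrow> k < length q"
  shows "graph_dist G u v = k"
  unfolding graph_dist_def
proof (rule Least_equality)
  show "\<exists>p. path_between G u v p \<and> length p - 1 = k"
    using assms(1,2) by auto
  show "k \<le> l" if "\<exists>p. path_between G u v p \<and> length p - 1 = l" for l
    using that assms(3) by fastforce
qed

text \<open>A path of one vertex has equal ends and a path of two vertices has adjacent ends, so distinct
leaves need the detour through the centre.\<close>

lemma graph_dist_star:
  assumes u: "u < Suc m" and v: "v < Suc m"
  shows "graph_dist (star_graph m) u v =
    (if u = v then 0 else if u < m \<and> v < m then 2 else 1)"
proof -
  let ?G = "star_graph m"
  have nonempty: "0 < length q" if "path_between ?G u v q" for q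
    using that by (auto simp: path_between_def)
  have two: "1 < length q" if "path_between ?G u v q" "u \<noteq> v" for q
    using that by (cases q; cases "tl q") (auto simp: path_between_def)
  have three: "2 < length q" if "path_between ?G u v q" "u \<noteq> v" "u < m" "v < m" for q
    using that by (cases q; cases "tl q"; cases "tl (tl q)") (auto simp: path_between_def adj_star)
  consider "u = v" | "u \<noteq> v" "u < m" "v < m" | "u \<noteq> v" "\<not> (u < m \<and> v < m)"
    by blast
  then show ?thesis
  proof cases
    case 1
    then have "path_between ?G u v [u]"
      using u by (simp add: path_between_def verts_star)
    then have "graph_dist ?G u v = 0"
      by (rule graph_dist_eqI) (use nonempty in auto)
    then show ?thesis using 1 by simp
  next
    case 2
    then have "path_between ?G u v [u, m, v]"
      by (simp add: path_between_def verts_star adj_star)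
    then have "graph_dist ?G u v = 2"
      by (rule graph_dist_eqI) (simp_all add: three 2)
    then show ?thesis using 2 by simp
  next
    case 3
    then have "path_between ?G u v [u, v]"
      using u v by (auto simp: path_between_def verts_star adj_star)
    then have "graph_dist ?G u v = 1"
      by (rule graph_dist_eqI) (simp_all add: two[unfolded One_nat_def] 3)
    then show ?thesis using 3 by simp
  qed
qed

lemma D_deg_plus_star:
  "D_deg_plus (star_graph m) = star_mat m (-1) 2 1 1 (int m)"
proof -
  have "fst (star_graph m) = Suc m" by (simp add: star_graph_def complete_bipartite_def)
  then show ?thesis
    unfolding D_deg_plus_def deg_mat_def dist_mat_def mat_diag_def star_mat_def
    by (intro eq_matI) (auto simp: vdegree_star graph_dist_star)
qed

lemma D_deg_star:
  "D_deg (star_graph m) = star_mat m 3 (-2) (-1) (-1) (int m)"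
proof -
  have "fst (star_graph m) = Suc m" by (simp add: star_graph_def complete_bipartite_def)
  then show ?thesis
    unfolding D_deg_def deg_mat_def dist_mat_def mat_diag_def star_mat_def
    by (intro eq_matI) (auto simp: vdegree_star graph_dist_star)
qed

section \<open>Reduction to diagonal form\<close>

lemma star_mat_GL:
  assumes "star_mat m a b c d e * star_mat m a' b' c' d' e' = star_mat m 1 0 0 0 1"
  shows "star_mat m a b c d e \<in> GL_int (Suc m)"
  using assms by (intro GL_intI[of _ _ "star_mat m a' b' c' d' e'"]) (simp_all add: star_mat_one)

text \<open>The left factor replaces the leaf row \<open>r\<^sub>i\<close> by \<open>2 r\<^sub>m - r\<^sub>i = e\<^sub>i + (2m - 1) e\<^sub>m\<close>, and the row of
the centre by the combination \<open>(2m - 1) r\<^sub>m - \<Sum>r\<^sub>i\<close>, whose entries on the leaves vanish.\<close>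

lemma D_deg_plus_star_equiv:
  "unimodular_equiv (Suc m) (star_mat m (-1) 2 1 1 (int m))
     (star_mat m 1 0 0 0 (2 * int m * (int m - 1)))"
proof -
  let ?t = "2 * int m - 1"
  have "star_mat m (-1) 0 2 (-1) ?t \<in> GL_int (Suc m)"
    by (rule star_mat_GL[of _ _ _ _ _ _ "-1" 2 "-2" 1 "-1"]) (simp add: star_mat_mult)
  moreover have "star_mat m 1 0 ?t 0 1 \<in> GL_int (Suc m)"
    by (rule star_mat_GL[of _ _ _ _ _ _ 1 0 "- ?t" 0 1]) (simp add: star_mat_mult)
  moreover have "star_mat m (-1) 0 2 (-1) ?t * star_mat m (-1) 2 1 1 (int m) =
      star_mat m 1 0 0 0 (2 * int m * (int m - 1)) * star_mat m 1 0 ?t 0 1"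
    by (simp add: star_mat_mult algebra_simps)
  ultimately show ?thesis
    unfolding unimodular_equiv_def by blast
qed

text \<open>The left factor subtracts twice the row of the centre from the leaf rows and then negates that
row; the right factor is the inverse of adding \<open>q\<close> times every leaf column to the last column.\<close>

lemma D_deg_star_equiv:
  fixes q s :: int
  assumes "2 * int m + 1 = 3 * q - s"
  shows "unimodular_equiv (Suc m) (star_mat m 3 (-2) (-1) (-1) (int m))
           (star_mat m 3 0 s 1 (int m * (q - 1)))"
proof -
  have s: "s = 3 * q - 2 * int m - 1" using assms by simp
  have "star_mat m 1 0 (-2) 0 (-1) \<in> GL_int (Suc m)"
    by (rule star_mat_GL[of _ _ _ _ _ _ 1 0 "-2" 0 "-1"]) (simp add: star_mat_mult)
  moreover have "star_mat m 1 0 (-q) 0 1 \<in> GL_int (Suc m)"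
    by (rule star_mat_GL[of _ _ _ _ _ _ 1 0 q 0 1]) (simp add: star_mat_mult)
  moreover have "star_mat m 1 0 (-2) 0 (-1) * star_mat m 3 (-2) (-1) (-1) (int m) =
      star_mat m 3 0 s 1 (int m * (q - 1)) * star_mat m 1 0 (-q) 0 1"
    by (simp add: star_mat_mult s algebra_simps)
  ultimately show ?thesis
    unfolding unimodular_equiv_def by blast
qed

definition arrow_mat :: "nat \<Rightarrow> int \<Rightarrow> int \<Rightarrow> int mat" where
  "arrow_mat m s D = mat (Suc m) (Suc m) (\<lambda>(i, j).
     if i = 0 then (if j = 0 then 1 else 0)
     else if i < m then (if j = i then 3 else 0) + (if j = m then s else 0)
     else (if j = m then D else 0))"

lemma arrow_mat_carrier [simp]: "arrow_mat m s D \<in> carrier_mat (Suc m) (Suc m)"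
  by (simp add: arrow_mat_def)

text \<open>Splitting off both ends of the summation range isolates the two exceptional indices, the leaf 0
and the centre, so that the summand is uniform over the remaining leaves.\<close>

lemma mat_mult_index_ends:
  fixes f g :: "nat \<times> nat \<Rightarrow> int"
  assumes "i < Suc (Suc n)" "j < Suc (Suc n)"
  shows "(mat (Suc (Suc n)) (Suc (Suc n)) f * mat (Suc (Suc n)) (Suc (Suc n)) g) $$ (i, j) =
    f (i, 0) * g (0, j) + (\<Sum>k = 0..<n. f (i, Suc k) * g (Suc k, j)) +
    f (i, Suc n) * g (Suc n, j)"
  unfolding mat_mult_index_sum[OF assms]
  by (subst sum.atLeast0_lessThan_Suc_shift, subst sum.atLeast0_lessThan_Suc) simp

lemma index_ends_cases:
  assumes "i < Suc (Suc n)"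
  obtains "i = 0" | i' where "i' < n" "i = Suc i'" | "i = Suc n"
  using assms by (cases i) (auto simp: less_Suc_eq)

lemmas entry_simps = sum.distrib distrib_left distrib_right
  left_diff_distrib right_diff_distrib sum_subtractf sum_delta_mult sum_negf
  sum_distrib_left[symmetric] sum_distrib_right[symmetric]

text \<open>With rows \<open>a\<^sub>i = 3 e\<^sub>i + s e\<^sub>m\<close> and \<open>a\<^sub>m = (1, \<dots>, 1, y)\<close>, the combination \<open>3 a\<^sub>m - \<Sum>a\<^sub>i\<close> is
supported on the last column. It involves \<open>a\<^sub>0\<close> with coefficient \<open>-1\<close>, so it may replace \<open>a\<^sub>0\<close>. The
row \<open>a\<^sub>m\<close> has entry 1 in column 0 and becomes the first basis vector after a column operation.\<close>

lemma star_mat_equiv_arrow_mat: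
  fixes s y :: int
  shows "unimodular_equiv (Suc (Suc n)) (star_mat (Suc n) 3 0 s 1 y)
    (arrow_mat (Suc n) s (3 * y - int (Suc n) * s))"
proof -
  let ?N = "Suc (Suc n)" and ?m = "Suc n"
  \<comment> \<open>\<open>P\<close> moves \<open>a\<^sub>m\<close> to the top and puts the combination \<open>3 a\<^sub>m - \<Sum>a\<^sub>i\<close> at the bottom; \<open>R\<close> has
    \<open>a\<^sub>m\<close> as its first row. The primed matrices are their inverses.\<close>
  define P :: "int mat" where "P = mat ?N ?N (\<lambda>(i, j).
     if i = 0 then (if j = ?m then 1 else 0) else if i < ?m then (if j = i then 1 else 0)
     else (if j < ?m then -1 else 3))"
  define P' :: "int mat" where "P' = mat ?N ?N (\<lambda>(i, j).
     if i = 0 then (if j = 0 then 3 else -1) else if i < ?m then (if j = i then 1 else 0)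
     else (if j = 0 then 1 else 0))"
  define R :: "int mat" where "R = mat ?N ?N (\<lambda>(i, j).
     if i = 0 then (if j < ?m then 1 else y) else (if j = i then 1 else 0))"
  define R' :: "int mat" where "R' = mat ?N ?N (\<lambda>(i, j).
     if i = 0 then (if j = 0 then 1 else if j < ?m then -1 else -y)
     else (if j = i then 1 else 0))"
  have carr: "P \<in> carrier_mat ?N ?N" "P' \<in> carrier_mat ?N ?N"
      "R \<in> carrier_mat ?N ?N" "R' \<in> carrier_mat ?N ?N"
    by (simp_all add: P_def P'_def R_def R'_def)
  have "P * P' = 1\<^sub>m ?N"
  proof (rule eq_matI)
    fix i j assume "i < dim_row (1\<^sub>m ?N :: int mat)" "j < dim_col (1\<^sub>m ?N :: int mat)"
    then have ij: "i < ?N" "j < ?N" by simp_all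
    show "(P * P') $$ (i, j) = 1\<^sub>m ?N $$ (i, j)"
      unfolding P_def P'_def mat_mult_index_ends[OF ij] using ij
      by (elim index_ends_cases) (simp_all add: entry_simps)
  qed (simp_all add: P_def P'_def)
  moreover have "R * R' = 1\<^sub>m ?N"
  proof (rule eq_matI)
    fix i j assume "i < dim_row (1\<^sub>m ?N :: int mat)" "j < dim_col (1\<^sub>m ?N :: int mat)"
    then have ij: "i < ?N" "j < ?N" by simp_all
    show "(R * R') $$ (i, j) = 1\<^sub>m ?N $$ (i, j)"
      unfolding R_def R'_def mat_mult_index_ends[OF ij] using ij
      by (elim index_ends_cases) (simp_all add: entry_simps)
  qed (simp_all add: R_def R'_def)
  moreover have "P * star_mat ?m 3 0 s 1 y = arrow_mat ?m s (3 * y - int ?m * s) * R"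
    (is "?L = ?R")
  proof (rule eq_matI)
    fix i j assume "i < dim_row ?R" "j < dim_col ?R"
    then have ij: "i < ?N" "j < ?N" by (simp_all add: R_def arrow_mat_def)
    show "?L $$ (i, j) = ?R $$ (i, j)"
      unfolding P_def R_def star_mat_def arrow_mat_def mat_mult_index_ends[OF ij] using ij
      by (elim index_ends_cases) (simp_all add: entry_simps)
  qed (simp_all add: P_def R_def star_mat_def arrow_mat_def)
  ultimately show ?thesis
    using carr by (intro unimodular_equivI[of P _ P' R R'])
qed

lemma index_start_cases:
  assumes "i < Suc m" "m \<ge> 2"
  obtains "i = 0" | "i = 1" | "2 \<le> i" "i < m" | "i = m"
  using assms by linarith

text \<open>When \<open>s\<close> is a unit, the entry \<open>s\<close> of the row \<open>b\<^sub>1 = 3 e\<^sub>1 + s e\<^sub>m\<close> is a pivot. Subtracting \<open>b\<^sub>1\<close>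
from the other rows \<open>b\<^sub>j\<close> leaves \<open>3 (e\<^sub>j - e\<^sub>1)\<close>, and \<open>D b\<^sub>1 - s (D e\<^sub>m) = 3 D e\<^sub>1\<close> trades the corner
entry \<open>D\<close> for \<open>3 D\<close>.\<close>

lemma arrow_mat_equiv_mat_diag:
  assumes m: "m \<ge> 2" and s: "s * s = (1::int)"
  shows "unimodular_equiv (Suc m) (arrow_mat m s D)
    (mat_diag (Suc m) (\<lambda>i. if i < 2 then 1 else if i < m then 3 else 3 * D))"
proof -
  let ?N = "Suc m"
  \<comment> \<open>The rows of \<open>R\<close> are \<open>e\<^sub>0\<close>, \<open>b\<^sub>1\<close>, the vectors \<open>e\<^sub>j - e\<^sub>1\<close> for \<open>2 \<le> j < m\<close>, and \<open>e\<^sub>1\<close>; \<open>P\<close> expresses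
    their multiples by the diagonal entries through the rows of \<open>arrow_mat\<close>. The primed matrices
    are the inverses.\<close>
  define P :: "int mat" where "P = mat ?N ?N (\<lambda>(i, j).
     if i < 2 then (if j = i then 1 else 0)
     else if i < m then (if j = i then 1 else 0) - (if j = 1 then 1 else 0)
     else (if j = 1 then D else 0) - (if j = m then s else 0))"
  define P' :: "int mat" where "P' = mat ?N ?N (\<lambda>(i, j).
     if i < 2 then (if j = i then 1 else 0)
     else if i < m then (if j = i then 1 else 0) + (if j = 1 then 1 else 0)
     else (if j = 1 then s * D else 0) - (if j = m then s else 0))"
  define R :: "int mat" where "R = mat ?N ?N (\<lambda>(i, j).
     if i = 0 then (if j = 0 then 1 else 0)
     else if i = 1 then (if j = 1 then 3 else 0) + (if j = m then s else 0)
     else if i < m then (if j = i then 1 else 0) - (if j = 1 then 1 else 0)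
     else (if j = 1 then 1 else 0))"
  define R' :: "int mat" where "R' = mat ?N ?N (\<lambda>(i, j).
     if i = 0 then (if j = 0 then 1 else 0)
     else if i = 1 then (if j = m then 1 else 0)
     else if i < m then (if j = i then 1 else 0) + (if j = m then 1 else 0)
     else (if j = 1 then s else 0) - (if j = m then 3 * s else 0))"
  have carr: "P \<in> carrier_mat ?N ?N" "P' \<in> carrier_mat ?N ?N"
      "R \<in> carrier_mat ?N ?N" "R' \<in> carrier_mat ?N ?N"
    by (simp_all add: P_def P'_def R_def R'_def)
  have s': "s * (s * x) = x" for x
    by (metis s mult.assoc mult_1)
  have "P * P' = 1\<^sub>m ?N"
  proof (rule eq_matI)
    fix i j assume "i < dim_row (1\<^sub>m ?N :: int mat)" "j < dim_col (1\<^sub>m ?N :: int mat)"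
    then have ij: "i < ?N" "j < ?N" by simp_all
    show "(P * P') $$ (i, j) = 1\<^sub>m ?N $$ (i, j)"
      unfolding P_def P'_def mat_mult_index_sum[OF ij] using ij
      by (elim index_start_cases[OF _ m]; insert m; simp add: entry_simps s s' del: One_nat_def)
  qed (simp_all add: P_def P'_def)
  moreover have "R * R' = 1\<^sub>m ?N"
  proof (rule eq_matI)
    fix i j assume "i < dim_row (1\<^sub>m ?N :: int mat)" "j < dim_col (1\<^sub>m ?N :: int mat)"
    then have ij: "i < ?N" "j < ?N" by simp_all
    show "(R * R') $$ (i, j) = 1\<^sub>m ?N $$ (i, j)"
      unfolding R_def R'_def mat_mult_index_sum[OF ij] using ij
      by (elim index_start_cases[OF _ m]; insert m; simp add: entry_simps s s' del: One_nat_def)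
  qed (simp_all add: R_def R'_def)
  moreover have "P * arrow_mat m s D =
      mat_diag ?N (\<lambda>i. if i < 2 then 1 else if i < m then 3 else 3 * D) * R"
    (is "?L = ?R")
  proof (rule eq_matI)
    fix i j assume "i < dim_row ?R" "j < dim_col ?R"
    then have ij: "i < ?N" "j < ?N" by (simp_all add: R_def mat_diag_def)
    show "?L $$ (i, j) = ?R $$ (i, j)"
      unfolding mat_diag_mult_left[OF carr(3)]
      unfolding P_def R_def arrow_mat_def mat_mult_index_sum[OF ij] using ij
      by (elim index_start_cases[OF _ m]; insert m; simp add: entry_simps s s' del: One_nat_def)
  qed (simp_all add: P_def R_def mat_diag_def arrow_mat_def)
  ultimately show ?thesis
    using carr by (intro unimodular_equivI[of P _ P' R R'])
qed

lemma arrow_mat_0_eq_mat_diag: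
  assumes "m \<ge> 1"
  shows "arrow_mat m 0 D = mat_diag (Suc m) (\<lambda>i. if i = 0 then 1 else if i < m then 3 else D)"
  using assms unfolding arrow_mat_def mat_diag_def by (intro eq_matI) auto

text \<open>The corner is \<open>3 m (q - 1) - m s = m (2m + 1 - 3) = 2 m (m - 1)\<close>, whatever \<open>q\<close> and \<open>s\<close> are.\<close>

lemma D_deg_star_equiv_arrow_mat:
  fixes q s :: int
  assumes m: "m \<ge> 1" and q: "2 * int m + 1 = 3 * q - s"
  shows "unimodular_equiv (Suc m) (D_deg (star_graph m)) (arrow_mat m s (2 * int m * (int m - 1)))"
proof -
  obtain n where n: "m = Suc n" using m by (cases m) auto
  have s: "s = 3 * q - 2 * int m - 1" using q by simp
  have "3 * (int m * (q - 1)) - int m * s = 2 * int m * (int m - 1)"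
    by (simp add: s algebra_simps)
  then have "unimodular_equiv (Suc m) (star_mat m 3 0 s 1 (int m * (q - 1)))
      (arrow_mat m s (2 * int m * (int m - 1)))"
    using star_mat_equiv_arrow_mat[of n s "int m * (q - 1)"] by (simp add: n)
  with D_deg_star_equiv[OF q] show ?thesis
    unfolding D_deg_star by (rule unimodular_equiv_trans) simp_all
qed

lemma smith_normal_form_D_deg_plus_star:
  assumes "m \<ge> 1"
  shows "is_smith_normal_form (Suc m) (D_deg_plus (star_graph m))
           (diag_of_list (replicate m 1 @ [2 * int m * (int m - 1)]))"
proof -
  let ?D = "2 * int m * (int m - 1)"
  define f where "f = (\<lambda>i. if i < m then 1 else ?D)"
  have "star_mat m 1 0 0 0 ?D = mat_diag (Suc m) f"
    unfolding star_mat_def mat_diag_def f_def by (intro eq_matI) auto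
  then have "unimodular_equiv (Suc m) (D_deg_plus (star_graph m)) (mat_diag (Suc m) f)"
    using D_deg_plus_star_equiv[of m] D_deg_plus_star[of m] by simp
  then have "is_smith_normal_form (Suc m) (D_deg_plus (star_graph m)) (mat_diag (Suc m) f)"
    using assms by (intro is_smith_normal_formI) (auto simp: f_def D_deg_plus_star)
  moreover have "diag_of_list (replicate m 1 @ [?D]) = mat_diag (Suc m) f"
    unfolding diag_of_list_def mat_diag_def f_def by (intro eq_matI) (auto simp: nth_append)
  ultimately show ?thesis by simp
qed

lemma smith_normal_form_D_deg_star_dvd:
  fixes a :: int
  assumes m: "m \<ge> 1" and a: "2 * int m + 1 = 3 * a"
  shows "is_smith_normal_form (Suc m) (D_deg (star_graph m))
           (diag_of_list ([1] @ replicate (m - 1) 3 @ [2 * int m * (int m - 1)]))"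
proof -
  let ?D = "2 * int m * (int m - 1)"
  define f where "f = (\<lambda>i. if i = 0 then 1 else if i < m then 3 else ?D)"
  have "2 * (int m - 1) = 3 * (a - 1)"
    using a by simp
  then have "?D = 3 * (int m * (a - 1))"
    by (metis mult.assoc mult.left_commute)
  then have "3 dvd ?D" by (metis dvd_triv_left)
  moreover have "unimodular_equiv (Suc m) (D_deg (star_graph m)) (mat_diag (Suc m) f)"
    using D_deg_star_equiv_arrow_mat[OF m, of a 0] a arrow_mat_0_eq_mat_diag[OF m] by (simp add: f_def)
  ultimately have "is_smith_normal_form (Suc m) (D_deg (star_graph m)) (mat_diag (Suc m) f)"
    using m by (intro is_smith_normal_formI) (auto simp: f_def D_deg_star)
  moreover have "diag_of_list ([1] @ replicate (m - 1) 3 @ [?D]) = mat_diag (Suc m) f"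
    unfolding diag_of_list_def mat_diag_def f_def using m
    by (intro eq_matI) (auto simp: nth_append nth_Cons')
  ultimately show ?thesis by simp
qed

lemma smith_normal_form_D_deg_star_not_dvd:
  assumes m: "m \<ge> 1" and a: "\<not> (\<exists>a::int. 2 * int m + 1 = 3 * a)"
  shows "is_smith_normal_form (Suc m) (D_deg (star_graph m))
           (diag_of_list ([1, 1] @ replicate (m - 2) 3 @ [6 * int m * (int m - 1)]))"
proof -
  let ?D = "2 * int m * (int m - 1)"
  \<comment> \<open>A single leaf gives \<open>2 m + 1 = 3\<close>, so here there is a second leaf to pivot on.\<close>
  have "m \<noteq> 1" using a by force
  with m have m2: "m \<ge> 2" by simp
  have "\<exists>q s :: int. 2 * int m + 1 = 3 * q - s \<and> s * s = 1"
  proof -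
    obtain q r :: int where qr: "2 * int m + 1 = 3 * q + r" "r = 0 \<or> r = 1 \<or> r = 2"
      by (rule that[of "(2 * int m + 1) div 3" "(2 * int m + 1) mod 3"]) presburger+
    then have "r = 1 \<or> r = 2" using a by auto
    then show ?thesis
    proof
      assume "r = 1"
      then show ?thesis using qr by (intro exI[of _ q] exI[of _ "-1"]) simp
    next
      assume "r = 2"
      then show ?thesis using qr by (intro exI[of _ "q + 1"] exI[of _ 1]) simp
    qed
  qed
  then obtain q s :: int where q: "2 * int m + 1 = 3 * q - s" and s: "s * s = 1"
    by blast
  define f where "f = (\<lambda>i. if i < 2 then 1 else if i < m then 3 else 3 * ?D)"
  have "unimodular_equiv (Suc m) (D_deg (star_graph m)) (mat_diag (Suc m) f)"
    using D_deg_star_equiv_arrow_mat[OF m q] arrow_mat_equiv_mat_diag[OF m2 s] unfolding f_def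
    by (rule unimodular_equiv_trans) (simp_all add: D_deg_star)
  then have "is_smith_normal_form (Suc m) (D_deg (star_graph m)) (mat_diag (Suc m) f)"
    using m2 by (intro is_smith_normal_formI) (auto simp: f_def D_deg_star)
  moreover have "diag_of_list ([1, 1] @ replicate (m - 2) 3 @ [6 * int m * (int m - 1)]) =
      mat_diag (Suc m) f"
    unfolding diag_of_list_def mat_diag_def f_def using m2
    by (intro eq_matI) (auto simp: nth_append nth_Cons')
  ultimately show ?thesis by simp
qed

theorem proposition3p13:
  fixes m :: nat
  assumes "m \<ge> 1"
  shows "is_smith_normal_form (m + 1) (D_deg_plus (complete_bipartite m 1))
           (diag_of_list (replicate m 1 @ [2 * int m * (int m - 1)])) \<and>
         is_smith_normal_form (m + 1) (D_deg (complete_bipartite m 1))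
           (if \<exists>a::int. 2 * int m + 1 = 3 * a
            then diag_of_list ([1] @ replicate (m - 1) 3 @ [2 * int m * (int m - 1)])
            else diag_of_list ([1, 1] @ replicate (m - 2) 3 @ [6 * int m * (int m - 1)]))"
  using smith_normal_form_D_deg_plus_star[OF assms] smith_normal_form_D_deg_star_dvd[OF assms]
    smith_normal_form_D_deg_star_not_dvd[OF assms]
  unfolding Suc_eq_plus1 star_graph_def by (auto simp del: One_nat_def)

end
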